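(* Let $I_{i,j}(\tau)$, $\tau\in[0,\tau^{\mathrm{final}}]$, be a moving quadrilateral cell whose four vertices move linearly in pseudo-time and which satisfies the mesh regularity assumption. Let $0=\tau^0<\tau^1<\dots<\tau^{N_\ell}=\tau^{\mathrm{final}}$ be pseudo-time levels, and for $s,r\in\mathbb{N}_0$ let the evolved geometric moments $\widetilde{\mathcal M}^{\ell}_{s,r,i,j}$ be computed by the SSPRK3 method described in the context, started from the exact moments $\widetilde{\mathcal M}^{0}_{s,r,i,j}=\mathcal M_{s,r,i,j}(0)$. Then the evolved geometric moments of degree at most two coincide with the exact geometric moments: for every $\ell=0,\dots,N_\ell-1$, $$\widetilde{\mathcal M}^{\ell+1}_{s,r,i,j}=\mathcal M_{s,r,i,j}(\tau^{\ell+1})\qquad\text{for all } s,r\in\mathbb N_0 \text{ with } s+r\le 2 .$$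
   Context: Moving cell. $I_{i,j}(\tau)\subset\mathbb R^2$ is the quadrilateral with vertices $A(\tau),B(\tau),C(\tau),D(\tau)$ where $\mathbf x_P(\tau)=\mathbf x_P^n+\tau\,\mathbf w_P$ for $P\in\{A,B,C,D\}$, with constant vertex velocities $\mathbf w_P=(\mathbf x_P^{n+1}-\mathbf x_P^n)/\tau^{\mathrm{final}}\in\mathbb R^2$. Mesh regularity assumption: for every $\tau\in[0,\tau^{\mathrm{final}}]$ the four vertices are pairwise distinct and strictly ordered counterclockwise, and $I_{i,j}(\tau)$ is a (nondegenerate) convex quadrilateral. Exact geometric moments: $\mathcal M_{s,r,i,j}(\tau)=\int_{I_{i,j}(\tau)}x^sy^r\,\mathrm dx\,\mathrm dy$. Semi-discrete moment operator. The edges are $l^1_{i,j}=AB$, $l^2_{i,j}=BC$, $l^3_{i,j}=CD$, $l^4_{i,j}=DA$; $|l^k_{i,j}|$ is the edge length and $\mathbf n_k$ its outward unit normal. On each edge the three-point Gauss--Lobatto rule is used: the quadrature points $\mathbf x_{k,g}=(x_{k,g},y_{k,g})$, $g=1,2,3$, are the first endpoint, the midpoint and the second endpoint of the edge, with weights $\omega_1=\omega_3=\tfrac16$, $\omega_2=\tfrac23$; the mesh velocity $\mathbf w_{k,g}$ at $\mathbf x_{k,g}$ is the linear interpolation along the edge of the velocities of the two edge endpoints. Define $$\mathcal L^{\widetilde{\mathcal M}_{s,r}}_{i,j}(I_{i,j}(\tau))=\sum_{k=1}^4|l^k_{i,j}|\sum_{g=1}^3\omega_g\,x_{k,g}^{\,s}\,y_{k,g}^{\,r}\,(\mathbf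 w_{k,g}\cdot\mathbf n_k),$$ all geometric quantities being those of $I_{i,j}(\tau)$. SSPRK3 update from $\tau^\ell$ to $\tau^{\ell+1}=\tau^\ell+\Delta\tau$ (where $\Delta\tau$ may depend on $\ell$). With $I^{\ell}_{i,j}=I_{i,j}(\tau^\ell)$, $I^{(1)}_{i,j}=I_{i,j}(\tau^\ell+\Delta\tau)$, $I^{(2)}_{i,j}=I_{i,j}(\tau^\ell+\tfrac12\Delta\tau)$, and writing $\mathcal L=\mathcal L^{\widetilde{\mathcal M}_{s,r}}_{i,j}$ and $\widetilde{\mathcal M}=\widetilde{\mathcal M}_{s,r,i,j}$: $$\widetilde{\mathcal M}^{(1)}=\widetilde{\mathcal M}^{\ell}+\Delta\tau\,\mathcal L(I^{\ell}_{i,j}),\quad \widetilde{\mathcal M}^{(2)}=\tfrac34\widetilde{\mathcal M}^{\ell}+\tfrac14\bigl[\widetilde{\mathcal M}^{(1)}+\Delta\tau\,\mathcal L(I^{(1)}_{i,j})\bigr],\quad \widetilde{\mathcal M}^{\ell+1}=\tfrac13\widetilde{\mathcal M}^{\ell}+\tfrac23\bigl[\widetilde{\mathcal M}^{(2)}+\Delta\tau\,\mathcal L(I^{(2)}_{i,j})\bigr].$$ *)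

theory Defs
  imports "HOL-Analysis.Analysis"
begin

type_synonym point = "real \<times> real"

text \<open>
  A quadrilateral is given by its vertices \<open>v 0, v 1, v 2, v 3\<close> (that is, \<open>A, B, C, D\<close>); the values
  of \<open>v\<close> at other indices are irrelevant. Edge \<open>k < 4\<close> runs from \<open>v k\<close> to \<open>v (nxt k)\<close>, so edges
  \<open>0, 1, 2, 3\<close> are \<open>AB, BC, CD, DA\<close>.
\<close>

definition nxt :: "nat \<Rightarrow> nat" where
  "nxt k = (k + 1) mod 4"

text \<open>The region is the convex hull of the vertices, as all quadrilaterals considered are convex.\<close>

definition quad :: "(nat \<Rightarrow> point) \<Rightarrow> point set" where
  "quad v = convex hull (v ` {..<4})"

text \<open>Twice the signed area of the triangle \<open>p q r\<close>; positive iff \<open>p, q, r\<close> is a left turn.\<close>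

definition orient :: "point \<Rightarrow> point \<Rightarrow> point \<Rightarrow> real" where
  "orient p q r = (fst q - fst p) * (snd r - snd p) - (snd q - snd p) * (fst r - fst p)"

definition strictly_ccw :: "(nat \<Rightarrow> point) \<Rightarrow> bool" where
  "strictly_ccw v \<longleftrightarrow> (\<forall>k<4. orient (v k) (v (nxt k)) (v (nxt (nxt k))) > 0)"

text \<open>
  The four points really are the four corners of their hull: none of them lies in the convex hull
  of the other three.
\<close>

definition convex_quadrilateral :: "(nat \<Rightarrow> point) \<Rightarrow> bool" where
  "convex_quadrilateral v \<longleftrightarrow>
     inj_on v {..<4} \<and> {p. p extreme_point_of quad v} = v ` {..<4}"

definition regular_cell :: "(nat \<Rightarrow> point) \<Rightarrow> bool" where
  "regular_cell v \<longleftrightarrow> inj_on v {..<4} \<and> strictly_ccw v \<and> convex_quadrilateral v"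

definition moment :: "nat \<Rightarrow> nat \<Rightarrow> (nat \<Rightarrow> point) \<Rightarrow> real" where
  "moment s r v = set_lebesgue_integral lborel (quad v) (\<lambda>p. fst p ^ s * snd p ^ r)"

definition edge_length :: "(nat \<Rightarrow> point) \<Rightarrow> nat \<Rightarrow> real" where
  "edge_length v k = dist (v k) (v (nxt k))"

text \<open>Unique for regular cells: unit, orthogonal to the edge, the cell on the nonpositive side.\<close>

definition outward_normal :: "(nat \<Rightarrow> point) \<Rightarrow> nat \<Rightarrow> point" where
  "outward_normal v k =
     (THE n. norm n = 1 \<and> n \<bullet> (v (nxt k) - v k) = 0 \<and> (\<forall>p\<in>quad v. n \<bullet> (p - v k) \<le> 0))"

text \<open>Three-point Gauss--Lobatto rule on the unit interval, \<open>g = 1, 2, 3\<close>.\<close>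

definition gl_node :: "nat \<Rightarrow> real" where
  "gl_node g = (if g = 1 then 0 else if g = 2 then 1/2 else 1)"

definition gl_weight :: "nat \<Rightarrow> real" where
  "gl_weight g = (if g = 2 then 2/3 else 1/6)"

text \<open>Linear interpolation of vertex data (positions or velocities) to a node of edge \<open>k\<close>.\<close>

definition edge_interp :: "(nat \<Rightarrow> point) \<Rightarrow> nat \<Rightarrow> nat \<Rightarrow> point" where
  "edge_interp u k g = (1 - gl_node g) *\<^sub>R u k + gl_node g *\<^sub>R u (nxt k)"

definition moment_operator ::
    "nat \<Rightarrow> nat \<Rightarrow> (nat \<Rightarrow> point) \<Rightarrow> (nat \<Rightarrow> point) \<Rightarrow> real" where
  "moment_operator s r w v =
     (\<Sum>k<4. edge_length v k *
        (\<Sum>g = 1..3. gl_weight g * fst (edge_interp v k g) ^ s * snd (edge_interp v k g) ^ r *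
           (edge_interp w k g \<bullet> outward_normal v k)))"

definition vertex_velocity ::
    "(nat \<Rightarrow> point) \<Rightarrow> (nat \<Rightarrow> point) \<Rightarrow> real \<Rightarrow> nat \<Rightarrow> point" where
  "vertex_velocity x\<^sub>0 x\<^sub>1 T k = (x\<^sub>1 k - x\<^sub>0 k) /\<^sub>R T"

definition moving_vertices ::
    "(nat \<Rightarrow> point) \<Rightarrow> (nat \<Rightarrow> point) \<Rightarrow> real \<Rightarrow> real \<Rightarrow> nat \<Rightarrow> point" where
  "moving_vertices x\<^sub>0 x\<^sub>1 T \<tau> k = x\<^sub>0 k + \<tau> *\<^sub>R vertex_velocity x\<^sub>0 x\<^sub>1 T k"

text \<open>
  One SSPRK3 step of size \<open>h\<close> from time \<open>t\<close> for a right-hand side depending on time only; the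
  stages are located at \<open>t\<close>, \<open>t + h\<close> and \<open>t + h/2\<close>.
\<close>

definition ssprk3_step :: "(real \<Rightarrow> real) \<Rightarrow> real \<Rightarrow> real \<Rightarrow> real \<Rightarrow> real" where
  "ssprk3_step L t h M =
     (let M1 = M + h * L t;
          M2 = 3/4 * M + 1/4 * (M1 + h * L (t + h))
      in 1/3 * M + 2/3 * (M2 + h * L (t + h/2)))"

primrec evolved_moment ::
    "nat \<Rightarrow> nat \<Rightarrow> (nat \<Rightarrow> point) \<Rightarrow> (nat \<Rightarrow> point) \<Rightarrow> real \<Rightarrow> (nat \<Rightarrow> real) \<Rightarrow> nat \<Rightarrow> real" where
  "evolved_moment s r x\<^sub>0 x\<^sub>1 T t 0 = moment s r (moving_vertices x\<^sub>0 x\<^sub>1 T 0)"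
| "evolved_moment s r x\<^sub>0 x\<^sub>1 T t (Suc l) =
     ssprk3_step
       (\<lambda>\<tau>. moment_operator s r (vertex_velocity x\<^sub>0 x\<^sub>1 T) (moving_vertices x\<^sub>0 x\<^sub>1 T \<tau>))
       (t l) (t (Suc l) - t l) (evolved_moment s r x\<^sub>0 x\<^sub>1 T t l)"

end

theory Submission imports Defs begin

text \<open>
  Splitting a convex cell into two triangles shows that its moment of degree at most 2 is the sum over
  the edges \<open>p q\<close> of the signed moments of the sectors \<open>0 p q\<close>, a polynomial in the vertices. When the
  vertices move linearly, a sector moment is a polynomial of degree at most 4 in time, and its
  derivative is the flux through \<open>p q\<close>, on which Gauss--Lobatto (Simpson) quadrature is exact, plus the
  fluxes through the sides \<open>0 p\<close> and \<open>q 0\<close>, which cancel in the sum over the edges. As the operator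
  depends on time only, an SSPRK3 step is Simpson's rule in time, exact for this cubic derivative.
\<close>

section \<open>Affine substitution in the plane\<close>

text \<open>Tonelli in both orders, since the two shears below act on different coordinates, each
  with the other held fixed.\<close>

lemma nn_integral_lborel_pair:
  fixes f :: "real \<times> real \<Rightarrow> ennreal"
  assumes [measurable]: "f \<in> borel_measurable borel"
  shows "(\<integral>\<^sup>+ p. f p \<partial>lborel) = (\<integral>\<^sup>+ x. \<integral>\<^sup>+ y. f (x, y) \<partial>lborel \<partial>lborel)"
    and "(\<integral>\<^sup>+ p. f p \<partial>lborel) = (\<integral>\<^sup>+ y. \<integral>\<^sup>+ x. f (x, y) \<partial>lborel \<partial>lborel)"
proof -
  have m: "f \<in> borel_measurable (lborel \<Otimes>\<^sub>M lborel)"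
    by (simp add: lborel_prod)
  show "(\<integral>\<^sup>+ p. f p \<partial>lborel) = (\<integral>\<^sup>+ x. \<integral>\<^sup>+ y. f (x, y) \<partial>lborel \<partial>lborel)"
    using lborel.nn_integral_fst[OF m] by (simp add: lborel_prod)
  show "(\<integral>\<^sup>+ p. f p \<partial>lborel) = (\<integral>\<^sup>+ y. \<integral>\<^sup>+ x. f (x, y) \<partial>lborel \<partial>lborel)"
    using lborel_pair.nn_integral_snd[of f] m by (simp add: lborel_prod case_prod_beta')
qed

text \<open>The matrix is factored into two shears and a diagonal scaling, which needs a nonzero pivot.\<close>

lemma nn_integral_lborel_affine_pivot:
  fixes f :: "real \<times> real \<Rightarrow> ennreal"
  assumes f[measurable]: "f \<in> borel_measurable borel"
    and det: "\<alpha> * \<delta> - \<beta> * \<gamma> \<noteq> 0" and pivot: "\<alpha> \<noteq> 0"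
  shows "(\<integral>\<^sup>+ p. f p \<partial>lborel) = ennreal \<bar>\<alpha> * \<delta> - \<beta> * \<gamma>\<bar> *
    (\<integral>\<^sup>+ p. f (a + \<alpha> * fst p + \<beta> * snd p, b + \<gamma> * fst p + \<delta> * snd p) \<partial>lborel)"
proof -
  \<comment> \<open>The second pivot of Gaussian elimination. At fixed \<open>x\<close> the
    substitution is \<open>y = b + \<gamma> / \<alpha> * (x - a) + e * v\<close>; then, at fixed
    \<open>v\<close>, it is \<open>x = (a + \<beta> * v) + \<alpha> * u\<close>.\<close>
  define e where "e = (\<alpha> * \<delta> - \<beta> * \<gamma>) / \<alpha>"
  have e: "e \<noteq> 0" using det pivot by (simp add: e_def)
  have \<alpha>e: "e * \<alpha> = \<alpha> * \<delta> - \<beta> * \<gamma>" using pivot by (simp add: e_def)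
  have \<gamma>: "\<gamma> * \<alpha> / \<alpha> = \<gamma>" and \<delta>: "\<gamma> / \<alpha> * \<beta> + e = \<delta>"
    using pivot by (simp_all add: e_def field_simps)
  define g where "g x v = f (x, b + \<gamma> / \<alpha> * (x - a) + e * v)" for x v
  have [measurable]: "(\<lambda>p. g (fst p) (snd p)) \<in> borel_measurable borel"
    unfolding g_def by (intro measurable_compose[OF _ f] borel_measurable_continuous_onI continuous_intros)
  have [measurable]: "(\<lambda>x. g x v) \<in> borel_measurable borel" for v
    unfolding g_def by measurable
  have "(\<integral>\<^sup>+ p. f p \<partial>lborel) = (\<integral>\<^sup>+ x. \<integral>\<^sup>+ y. f (x, y) \<partial>lborel \<partial>lborel)"
    by (rule nn_integral_lborel_pair) measurable
  also have "\<dots> = (\<integral>\<^sup>+ x. ennreal \<bar>e\<bar> * (\<integral>\<^sup>+ v. g x v \<partial>lborel) \<partial>lborel)"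
    unfolding g_def by (intro nn_integral_cong nn_integral_real_affine e) measurable
  also have "\<dots> = ennreal \<bar>e\<bar> * (\<integral>\<^sup>+ x. (\<integral>\<^sup>+ v. g x v \<partial>lborel) \<partial>lborel)"
    unfolding g_def by (intro nn_integral_cmult) measurable
  also have "(\<integral>\<^sup>+ x. (\<integral>\<^sup>+ v. g x v \<partial>lborel) \<partial>lborel) = (\<integral>\<^sup>+ v. (\<integral>\<^sup>+ x. g x v \<partial>lborel) \<partial>lborel)"
    using nn_integral_lborel_pair[of "\<lambda>p. g (fst p) (snd p)"] by simp
  also have "\<dots> = (\<integral>\<^sup>+ v. ennreal \<bar>\<alpha>\<bar> * (\<integral>\<^sup>+ u. g ((a + \<beta> * v) + \<alpha> * u) v \<partial>lborel) \<partial>lborel)"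
    by (intro nn_integral_cong nn_integral_real_affine pivot) measurable
  also have "\<dots> = ennreal \<bar>\<alpha>\<bar> * (\<integral>\<^sup>+ v. (\<integral>\<^sup>+ u. g ((a + \<beta> * v) + \<alpha> * u) v \<partial>lborel) \<partial>lborel)"
    unfolding g_def by (intro nn_integral_cmult) measurable
  also have "(\<lambda>v u. g ((a + \<beta> * v) + \<alpha> * u) v)
      = (\<lambda>v u. f (a + \<alpha> * u + \<beta> * v, b + \<gamma> * u + \<delta> * v))"
  proof (intro ext)
    fix u v
    have "b + \<gamma> / \<alpha> * (\<beta> * v + \<alpha> * u) + e * v = b + (\<gamma> * \<alpha> / \<alpha>) * u + (\<gamma> / \<alpha> * \<beta> + e) * v"
      by (simp add: algebra_simps)
    then show "g ((a + \<beta> * v) + \<alpha> * u) v = f (a + \<alpha> * u + \<beta> * v, b + \<gamma> * u + \<delta> * v)"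
      unfolding g_def \<gamma> \<delta> by (simp add: algebra_simps)
  qed
  also have "(\<integral>\<^sup>+ v. (\<integral>\<^sup>+ u. f (a + \<alpha> * u + \<beta> * v, b + \<gamma> * u + \<delta> * v) \<partial>lborel) \<partial>lborel)
      = (\<integral>\<^sup>+ p. f (a + \<alpha> * fst p + \<beta> * snd p, b + \<gamma> * fst p + \<delta> * snd p) \<partial>lborel)"
    by (subst nn_integral_lborel_pair(2))
      (simp_all add: measurable_compose[OF _ f] borel_measurable_continuous_onI continuous_intros)
  finally show ?thesis
    using \<alpha>e by (simp add: mult.assoc[symmetric] ennreal_mult[symmetric] abs_mult[symmetric])
qed

text \<open>If \<open>\<alpha> = 0\<close>, the nonzero determinant forces
  \<open>\<gamma> \<noteq> 0\<close>. Swapping the coordinates of the argument of \<open>f\<close>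
  then makes \<open>\<gamma>\<close> the pivot and only flips the sign of the determinant.\<close>

lemma nn_integral_lborel_affine:
  fixes f :: "real \<times> real \<Rightarrow> ennreal"
  assumes f[measurable]: "f \<in> borel_measurable borel"
    and det: "\<alpha> * \<delta> - \<beta> * \<gamma> \<noteq> 0"
  shows "(\<integral>\<^sup>+ p. f p \<partial>lborel) = ennreal \<bar>\<alpha> * \<delta> - \<beta> * \<gamma>\<bar> *
    (\<integral>\<^sup>+ p. f (a + \<alpha> * fst p + \<beta> * snd p, b + \<gamma> * fst p + \<delta> * snd p) \<partial>lborel)"
proof (cases "\<alpha> = 0")
  case False
  then show ?thesis using nn_integral_lborel_affine_pivot[OF f det] by simp
next
  case True
  have swap: "(\<lambda>p. f (snd p, fst p)) \<in> borel_measurable borel"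
    by (intro measurable_compose[OF _ f] borel_measurable_continuous_onI continuous_intros)
  from True have "\<gamma> \<noteq> 0" and det': "\<gamma> * \<beta> - \<delta> * \<alpha> \<noteq> 0" using det by auto
  have "(\<integral>\<^sup>+ p. f p \<partial>lborel) = (\<integral>\<^sup>+ p. f (snd p, fst p) \<partial>lborel)"
    by (subst nn_integral_lborel_pair(1)[OF f], subst nn_integral_lborel_pair(2)[OF swap]) simp
  also have "\<dots> = ennreal \<bar>\<gamma> * \<beta> - \<delta> * \<alpha>\<bar> *
      (\<integral>\<^sup>+ p. f (a + \<alpha> * fst p + \<beta> * snd p, b + \<gamma> * fst p + \<delta> * snd p) \<partial>lborel)"
    by (subst nn_integral_lborel_affine_pivot[OF swap det' \<open>\<gamma> \<noteq> 0\<close>, of b a]) simp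
  also have "\<bar>\<gamma> * \<beta> - \<delta> * \<alpha>\<bar> = \<bar>\<alpha> * \<delta> - \<beta> * \<gamma>\<bar>"
    by (simp add: abs_minus_commute mult.commute)
  finally show ?thesis .
qed

text \<open>Applied to indicators, the nonnegative case says that \<open>lborel\<close> is a
  constant density over its pushforward under the affine map. Equality of measures transfers to
  signed integrands with no separate integrability argument.\<close>

lemma integral_lborel_affine:
  fixes f :: "real \<times> real \<Rightarrow> real"
  assumes f[measurable]: "f \<in> borel_measurable borel"
    and det: "\<alpha> * \<delta> - \<beta> * \<gamma> \<noteq> 0"
  shows "integral\<^sup>L lborel f = \<bar>\<alpha> * \<delta> - \<beta> * \<gamma>\<bar> *
    (\<integral> p. f (a + \<alpha> * fst p + \<beta> * snd p, b + \<gamma> * fst p + \<delta> * snd p) \<partial>lborel)"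
proof -
  define \<Phi> where "\<Phi> = (\<lambda>p. (a + \<alpha> * fst p + \<beta> * snd p, b + \<gamma> * fst p + \<delta> * snd p) :: real \<times> real)"
  have [measurable]: "\<Phi> \<in> borel_measurable borel"
    unfolding \<Phi>_def by (intro borel_measurable_continuous_onI continuous_intros)
  have "(lborel :: (real \<times> real) measure)
      = density (distr lborel borel \<Phi>) (\<lambda>_. ennreal \<bar>\<alpha> * \<delta> - \<beta> * \<gamma>\<bar>)" (is "_ = ?D")
  proof (rule measure_eqI)
    fix X :: "(real \<times> real) set" assume "X \<in> sets lborel"
    then have [measurable]: "X \<in> sets borel" by simp
    have "(\<lambda>p. indicator X (\<Phi> p) :: ennreal) = indicator (\<Phi> -` X)"
      by (auto split: split_indicator)
    moreover have "\<Phi> -` X \<in> sets borel" using measurable_sets_borel[of \<Phi> borel X] by simp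
    ultimately have ind: "(\<integral>\<^sup>+ p. indicator X (\<Phi> p) \<partial>lborel) = emeasure lborel (\<Phi> -` X)"
      by simp
    have "emeasure lborel X = (\<integral>\<^sup>+ p. indicator X p \<partial>lborel)" by simp
    also have "\<dots> = ennreal \<bar>\<alpha> * \<delta> - \<beta> * \<gamma>\<bar> * (\<integral>\<^sup>+ p. indicator X (\<Phi> p) \<partial>lborel)"
      unfolding \<Phi>_def by (rule nn_integral_lborel_affine[OF _ det]) measurable
    also have "\<dots> = emeasure ?D X"
      by (simp add: ind emeasure_density nn_integral_cmult emeasure_distr)
    finally show "emeasure lborel X = emeasure ?D X" .
  qed simp
  then have "integral\<^sup>L lborel f = integral\<^sup>L ?D f" by simp
  also have "\<dots> = \<bar>\<alpha> * \<delta> - \<beta> * \<gamma>\<bar> * (\<integral> p. f (\<Phi> p) \<partial>lborel)"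
    by (subst integral_density) (simp_all add: integral_distr)
  finally show ?thesis by (simp add: \<Phi>_def)
qed

section \<open>Moments of a triangle\<close>

definition unit_triangle :: "(real \<times> real) set" where
  "unit_triangle = {p. 0 \<le> fst p \<and> 0 \<le> snd p \<and> fst p + snd p \<le> 1}"

lemma compact_unit_triangle: "compact unit_triangle"
proof -
  have "closed unit_triangle"
    unfolding unit_triangle_def
    by (intro closed_Collect_conj closed_Collect_le continuous_intros)
  moreover have "unit_triangle \<subseteq> {0..1} \<times> {0..1}"
    by (auto simp: unit_triangle_def)
  ultimately show ?thesis
    by (metis bounded_Times bounded_closed_interval bounded_subset compact_eq_bounded_closed)
qed

text \<open>Fubini, with integrability from compactness, and the fundamental theorem of calculus
  applied once in each variable.\<close>

lemma integral_unit_triangle_quadratic: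
  fixes c c1 c2 d1 d2 d3 :: real
  defines "q \<equiv> \<lambda>p. c + c1 * fst p + c2 * snd p + d1 * fst p ^ 2 + d2 * (fst p * snd p) + d3 * snd p ^ 2"
  shows "(\<integral> p. indicator unit_triangle p * q p \<partial>lborel) = c / 2 + (c1 + c2) / 6 + (d1 + d3) / 12 + d2 / 24"
proof -
  have int: "integrable lborel (\<lambda>p. indicator unit_triangle p * q p)"
    using borel_integrable_compact[OF compact_unit_triangle, of q]
    unfolding q_def by (simp add: continuous_intros)
  \<comment> \<open>Antiderivative of \<open>q (u, y)\<close> in \<open>y\<close>, vanishing at
    \<open>y = 0\<close>.\<close>
  define G where "G u y = c * y + c1 * u * y + c2 * y^2/2 + d1 * u^2 * y + d2 * u * y^2/2 + d3 * y^3/3"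
    for u y :: real
  have inner: "(\<integral> y. indicator unit_triangle (u, y) * q (u, y) \<partial>lborel) = G u (1 - u) * indicator {0..1} u" for u
  proof (cases "0 \<le> u \<and> u \<le> 1")
    case True
    have "(\<integral> y. indicator unit_triangle (u, y) * q (u, y) \<partial>lborel)
        = (\<integral> y. q (u, y) * indicator {0..1 - u} y \<partial>lborel)"
      using True by (intro Bochner_Integration.integral_cong) (auto simp: unit_triangle_def split: split_indicator)
    also have "\<dots> = G u (1 - u) - G u 0"
      using True unfolding G_def q_def
      by (intro integral_FTC_Icc_real) (auto intro!: derivative_eq_intros continuous_intros simp: field_simps power2_eq_square)
    finally show ?thesis using True by (simp add: G_def)
  next
    case False
    then have "(\<lambda>y. indicator unit_triangle (u, y) * q (u, y)) = (\<lambda>_. 0)"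
      by (auto simp: unit_triangle_def split: split_indicator)
    then show ?thesis using False by simp
  qed
  \<comment> \<open>Antiderivative of \<open>G u (1 - u)\<close> in \<open>u\<close>, term by term
    after expanding the powers of \<open>1 - u\<close>.\<close>
  define H where "H u = c * (u - u^2/2) + c1 * (u^2/2 - u^3/3) + c2 / 2 * (u - u^2 + u^3/3) + d1 * (u^3/3 - u^4/4)
     + d2 / 2 * (u^2/2 - 2*u^3/3 + u^4/4) + d3 / 3 * (u - 3*u^2/2 + u^3 - u^4/4)" for u :: real
  have "(\<integral> p. indicator unit_triangle p * q p \<partial>lborel)
      = (\<integral> u. (\<integral> y. indicator unit_triangle (u, y) * q (u, y) \<partial>lborel) \<partial>lborel)"
    using lborel_pair.integral_fst'[of "\<lambda>p. indicator unit_triangle p * q p"] int by (simp add: lborel_prod)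
  also have "\<dots> = H 1 - H 0"
    unfolding inner H_def G_def
    by (intro integral_FTC_Icc_real)
      (auto intro!: derivative_eq_intros continuous_intros simp: field_simps power2_eq_square power3_eq_cube)
  finally show ?thesis by (simp add: H_def field_simps)
qed

definition power_xy :: "nat \<Rightarrow> nat \<Rightarrow> point \<Rightarrow> real" where
  "power_xy s r p = fst p ^ s * snd p ^ r"

definition mid :: "point \<Rightarrow> point \<Rightarrow> point" where
  "mid p q = (1/2) *\<^sub>R p + (1/2) *\<^sub>R q"

lemma fst_mid [simp]: "fst (mid p q) = (fst p + fst q) / 2"
  and snd_mid [simp]: "snd (mid p q) = (snd p + snd q) / 2"
  by (simp_all add: mid_def)

lemma degree_le_2_cases:
  assumes "s + r \<le> (2::nat)"
  obtains "s = 0" "r = 0" | "s = 1" "r = 0" | "s = 0" "r = 1"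
    | "s = 2" "r = 0" | "s = 1" "r = 1" | "s = 0" "r = 2"
proof -
  have "s = 0 \<and> r = 0 \<or> s = 1 \<and> r = 0 \<or> s = 0 \<and> r = 1 \<or>
      s = 2 \<and> r = 0 \<or> s = 1 \<and> r = 1 \<or> s = 0 \<and> r = 2"
    using assms by presburger
  then show thesis using that by blast
qed

text \<open>On quadratic polynomials the edge midpoint rule is exact for triangles.\<close>

lemma integral_unit_triangle_affine:
  assumes "s + r \<le> 2"
  shows "(\<integral> p. indicator unit_triangle p *
      power_xy s r (a1 + b1 * fst p + c1 * snd p, a2 + b2 * fst p + c2 * snd p) \<partial>lborel)
    = (power_xy s r (a1 + b1 / 2, a2 + b2 / 2) + power_xy s r (a1 + c1 / 2, a2 + c2 / 2)
       + power_xy s r (a1 + (b1 + c1) / 2, a2 + (b2 + c2) / 2)) / 6"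
  using assms
proof (cases rule: degree_le_2_cases)
  case 1
  then show ?thesis
    using integral_unit_triangle_quadratic[of 1 0 0 0 0 0] by (simp add: power_xy_def)
next
  case 2
  then show ?thesis
    using integral_unit_triangle_quadratic[of a1 b1 c1 0 0 0] by (simp add: power_xy_def field_simps)
next
  case 3
  then show ?thesis
    using integral_unit_triangle_quadratic[of a2 b2 c2 0 0 0] by (simp add: power_xy_def field_simps)
next
  case 4
  have "(a1 + b1 * fst p + c1 * snd p)\<^sup>2 = a1^2 + (2*a1*b1) * fst p + (2*a1*c1) * snd p
      + b1^2 * fst p ^ 2 + (2*b1*c1) * (fst p * snd p) + c1^2 * snd p ^ 2" for p :: "real \<times> real"
    by algebra
  then show ?thesis
    using 4 integral_unit_triangle_quadratic[of "a1^2" "2*a1*b1" "2*a1*c1" "b1^2" "2*b1*c1" "c1^2"]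
    by (simp add: power_xy_def field_simps power2_eq_square)
next
  case 5
  have "(a1 + b1 * fst p + c1 * snd p) * (a2 + b2 * fst p + c2 * snd p)
      = a1*a2 + (a1*b2+b1*a2) * fst p + (a1*c2+c1*a2) * snd p
      + (b1*b2) * fst p ^ 2 + (b1*c2+c1*b2) * (fst p * snd p) + (c1*c2) * snd p ^ 2" for p :: "real \<times> real"
    by algebra
  then show ?thesis
    using 5 integral_unit_triangle_quadratic[of "a1*a2" "a1*b2+b1*a2" "a1*c2+c1*a2" "b1*b2" "b1*c2+c1*b2" "c1*c2"]
    by (simp add: power_xy_def field_simps power2_eq_square)
next
  case 6
  have "(a2 + b2 * fst p + c2 * snd p)\<^sup>2 = a2^2 + (2*a2*b2) * fst p + (2*a2*c2) * snd p
      + b2^2 * fst p ^ 2 + (2*b2*c2) * (fst p * snd p) + c2^2 * snd p ^ 2" for p :: "real \<times> real"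
    by algebra
  then show ?thesis
    using 6 integral_unit_triangle_quadratic[of "a2^2" "2*a2*b2" "2*a2*c2" "b2^2" "2*b2*c2" "c2^2"]
    by (simp add: power_xy_def field_simps power2_eq_square)
qed

text \<open>The triangle is the image of the unit triangle under the affine map. Since the map is
  injective, a point of the triangle has no parameters outside the unit triangle.\<close>

lemma affine_image_mem_triangle_iff:
  assumes "orient a b c \<noteq> 0"
  shows "(fst a + (fst b - fst a) * u + (fst c - fst a) * v,
      snd a + (snd b - snd a) * u + (snd c - snd a) * v) \<in> convex hull {a, b, c}
    \<longleftrightarrow> (u, v) \<in> unit_triangle"
proof -
  define \<Phi> where "\<Phi> u v = (fst a + (fst b - fst a) * u + (fst c - fst a) * v,
      snd a + (snd b - snd a) * u + (snd c - snd a) * v)" for u v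
  have \<Phi>: "\<Phi> u v = a + u *\<^sub>R (b - a) + v *\<^sub>R (c - a)" for u v
    by (simp add: \<Phi>_def prod_eq_iff algebra_simps)
  have inj: "u = u' \<and> v = v'" if "\<Phi> u v = \<Phi> u' v'" for u v u' v'
  proof -
    \<comment> \<open>Cramer's rule: \<open>orient a b c\<close> is the determinant of the linear
      part.\<close>
    have "(u - u') * orient a b c = 0" "(v - v') * orient a b c = 0"
      using that unfolding \<Phi>_def orient_def prod.inject by algebra+
    then show ?thesis using assms by simp
  qed
  have "\<Phi> u v \<in> convex hull {a, b, c} \<longleftrightarrow> (\<exists>u' v'. \<Phi> u v = \<Phi> u' v' \<and> 0 \<le> u' \<and> 0 \<le> v' \<and> u' + v' \<le> 1)"
    by (auto simp: convex_hull_3_alt \<Phi>)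
  also have "\<dots> \<longleftrightarrow> (u, v) \<in> unit_triangle"
    unfolding unit_triangle_def using inj by fastforce
  finally show ?thesis by (simp add: \<Phi>_def)
qed

lemma closed_triangle: "closed (convex hull {a, b, c :: point})"
  by (simp add: compact_imp_closed finite_imp_compact_convex_hull)

lemma power_xy_measurable [measurable]: "power_xy s r \<in> borel_measurable borel"
  unfolding power_xy_def by (intro borel_measurable_continuous_onI continuous_intros)

text \<open>Pullback to the unit triangle. The Jacobian \<open>orient a b c\<close> is twice the
  area, so each edge midpoint gets a third of the area as its weight.\<close>

lemma triangle_moment:
  assumes orient: "orient a b c > 0" and deg: "s + r \<le> 2"
  shows "set_lebesgue_integral lborel (convex hull {a, b, c}) (power_xy s r)
    = orient a b c / 6 * (power_xy s r (mid a b) + power_xy s r (mid b c) + power_xy s r (mid c a))"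
proof -
  let ?\<Phi> = "\<lambda>p. (fst a + (fst b - fst a) * fst p + (fst c - fst a) * snd p,
      snd a + (snd b - snd a) * fst p + (snd c - snd a) * snd p)"
  have [measurable]: "convex hull {a, b, c} \<in> sets borel"
    by (simp add: closed_triangle borel_closed)
  have det: "(fst b - fst a) * (snd c - snd a) - (fst c - fst a) * (snd b - snd a) = orient a b c"
    by (simp add: orient_def algebra_simps)
  have "set_lebesgue_integral lborel (convex hull {a, b, c}) (power_xy s r)
      = orient a b c * (\<integral> p. indicator (convex hull {a, b, c}) (?\<Phi> p) * power_xy s r (?\<Phi> p) \<partial>lborel)"
    unfolding set_lebesgue_integral_def
    by (subst integral_lborel_affine[where a = "fst a" and b = "snd a"
          and \<alpha> = "fst b - fst a" and \<beta> = "fst c - fst a" and \<gamma> = "snd b - snd a" and \<delta> = "snd c - snd a"])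
      (use orient in \<open>simp_all add: det\<close>)
  also have "(\<lambda>p. indicator (convex hull {a, b, c}) (?\<Phi> p) * power_xy s r (?\<Phi> p))
      = (\<lambda>p. indicator unit_triangle p * power_xy s r (?\<Phi> p))"
    using affine_image_mem_triangle_iff[of a b c] orient by (auto simp: indicator_def fun_eq_iff)
  also have "(\<integral> p. indicator unit_triangle p * power_xy s r (?\<Phi> p) \<partial>lborel)
      = (power_xy s r (mid a b) + power_xy s r (mid b c) + power_xy s r (mid c a)) / 6"
  proof -
    have "x + (y - x) / 2 = (x + y) / 2" "x + (z - x) / 2 = (x + z) / 2"
      "x + ((y - x) + (z - x)) / 2 = (y + z) / 2" for x y z :: real
      by (simp_all add: field_simps)
    note eqs = this
    show ?thesis
      unfolding integral_unit_triangle_affine[OF deg] eqs by (simp add: power_xy_def add_ac)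
  qed
  finally show ?thesis by simp
qed

section \<open>Moments of a convex quadrilateral\<close>

lemma mem_convex_hull_4E:
  fixes a b c d :: "'a::real_vector"
  assumes "p \<in> convex hull {a, b, c, d}"
  obtains \<alpha> \<beta> \<gamma> \<delta> where "0 \<le> \<alpha>" "0 \<le> \<beta>" "0 \<le> \<gamma>" "0 \<le> \<delta>" "\<alpha> + \<beta> + \<gamma> + \<delta> = 1"
    and "p = \<alpha> *\<^sub>R a + \<beta> *\<^sub>R b + \<gamma> *\<^sub>R c + \<delta> *\<^sub>R d"
proof -
  obtain \<alpha> m e where 1: "0 \<le> \<alpha>" "0 \<le> m" "\<alpha> + m = 1" "p = \<alpha> *\<^sub>R a + m *\<^sub>R e"
    and "e \<in> convex hull {b, c, d}"
    using assms by (auto simp: convex_hull_insert[of "{b, c, d}" a])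
  then obtain u v w where 2: "0 \<le> u" "0 \<le> v" "0 \<le> w" "u + v + w = 1"
    and e: "e = u *\<^sub>R b + v *\<^sub>R c + w *\<^sub>R d"
    unfolding convex_hull_3 by blast
  show thesis
  proof (rule that[of \<alpha> "m * u" "m * v" "m * w"])
    have "m * u + m * v + m * w = m" using 2 by (metis distrib_left mult.right_neutral)
    then show "\<alpha> + m * u + m * v + m * w = 1" using 1 by simp
    show "p = \<alpha> *\<^sub>R a + (m * u) *\<^sub>R b + (m * v) *\<^sub>R c + (m * w) *\<^sub>R d"
      using 1 by (simp add: e algebra_simps)
  qed (use 1 2 in auto)
qed

text \<open>
  The diagonals cross in a point that is a convex combination both of \<open>b, d\<close> and of \<open>a, c\<close>. Trading
  the first combination for the second, one of the weights of \<open>b\<close> and \<open>d\<close> can be made to vanish.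
\<close>

lemma quadrilateral_eq_Un_triangles:
  assumes abc: "orient a b c > 0" and bcd: "orient b c d > 0"
    and cda: "orient c d a > 0" and dab: "orient d a b > 0"
  shows "convex hull {a, b, c, d} = convex hull {a, b, c} \<union> convex hull {a, c, d}"
proof
  show "convex hull {a, b, c} \<union> convex hull {a, c, d} \<subseteq> convex hull {a, b, c, d}"
    by (intro Un_least hull_mono) auto
  show "convex hull {a, b, c, d} \<subseteq> convex hull {a, b, c} \<union> convex hull {a, c, d}"
  proof
    fix p assume "p \<in> convex hull {a, b, c, d}"
    then obtain \<alpha> \<beta> \<gamma> \<delta> where nonneg: "0 \<le> \<alpha>" "0 \<le> \<beta>" "0 \<le> \<gamma>" "0 \<le> \<delta>"
      and sum: "\<alpha> + \<beta> + \<gamma> + \<delta> = 1"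
      and p: "p = \<alpha> *\<^sub>R a + \<beta> *\<^sub>R b + \<gamma> *\<^sub>R c + \<delta> *\<^sub>R d"
      by (rule mem_convex_hull_4E)
    define x y z w where "x = orient b c d" and "y = orient c d a"
      and "z = orient d a b" and "w = orient a b c"
    note xyzw_def = x_def y_def z_def w_def
    have pos: "0 < x" "0 < y" "0 < z" "0 < w" using assms by (simp_all add: xyzw_def)
    \<comment> \<open>The affine dependence of four points in the plane: each coefficient is the
      signed area of the triangle omitting that vertex. Divided by the common sum, both sides of the
      next relation are the crossing point of the diagonals.\<close>
    have "x + z = y + w" by (simp add: xyzw_def orient_def algebra_simps)
    moreover have "x *\<^sub>R a + z *\<^sub>R c = y *\<^sub>R b + w *\<^sub>R d"
      unfolding prod_eq_iff xyzw_def orient_def by (simp add: algebra_simps)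
    ultimately have trade: "p = (\<alpha> + t * x) *\<^sub>R a + (\<beta> - t * y) *\<^sub>R b + (\<gamma> + t * z) *\<^sub>R c + (\<delta> - t * w) *\<^sub>R d"
        "(\<alpha> + t * x) + (\<beta> - t * y) + (\<gamma> + t * z) + (\<delta> - t * w) = 1" for t
    proof -
      assume *: "x + z = y + w" "x *\<^sub>R a + z *\<^sub>R c = y *\<^sub>R b + w *\<^sub>R d"
      have "t *\<^sub>R (x *\<^sub>R a + z *\<^sub>R c) = t *\<^sub>R (y *\<^sub>R b + w *\<^sub>R d)" using * by simp
      then show "p = (\<alpha> + t * x) *\<^sub>R a + (\<beta> - t * y) *\<^sub>R b + (\<gamma> + t * z) *\<^sub>R c + (\<delta> - t * w) *\<^sub>R d"
        unfolding p by (simp add: algebra_simps)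
      have "t * (x + z) = t * (y + w)" using * by simp
      then show "(\<alpha> + t * x) + (\<beta> - t * y) + (\<gamma> + t * z) + (\<delta> - t * w) = 1"
        using sum by (simp add: algebra_simps)
    qed
    show "p \<in> convex hull {a, b, c} \<union> convex hull {a, c, d}"
    \<comment> \<open>The smaller quotient is the largest \<open>t\<close> that keeps the weights of
      both \<open>b\<close> and \<open>d\<close> nonnegative, and it makes one of them zero.\<close>
    proof (cases "\<beta> / y \<le> \<delta> / w")
      case True
      define t where "t = \<beta> / y"
      have "\<beta> - t * y = 0" "0 \<le> t" "t * w \<le> \<delta>"
        using True pos nonneg by (simp_all add: t_def field_simps)
      with trade[of t] have "p \<in> convex hull {a, c, d}"
        unfolding convex_hull_3 using pos nonneg
        by (intro CollectI exI[of _ "\<alpha> + t * x"] exI[of _ "\<gamma> + t * z"] exI[of _ "\<delta> - t * w"]) simp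
      then show ?thesis by blast
    next
      case False
      define t where "t = \<delta> / w"
      have "\<delta> - t * w = 0" "0 \<le> t" "t * y \<le> \<beta>"
        using False pos nonneg by (simp_all add: t_def field_simps)
      with trade[of t] have "p \<in> convex hull {a, b, c}"
        unfolding convex_hull_3 using pos nonneg
        by (intro CollectI exI[of _ "\<alpha> + t * x"] exI[of _ "\<beta> - t * y"] exI[of _ "\<gamma> + t * z"]) simp
      then show ?thesis by blast
    qed
  qed
qed

text \<open>The planar determinant, twice the signed area of the triangle \<open>0 p q\<close>.
  Paired with an edge vector it also gives the flux of a velocity through that edge.\<close>

definition cross :: "point \<Rightarrow> point \<Rightarrow> real" where
  "cross p q = fst p * snd q - snd p * fst q"

text \<open>The triangles lie on opposite sides of the line through \<open>a\<close> and
  \<open>c\<close>, so they meet inside that line.\<close>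

lemma triangles_overlap_null:
  assumes abc: "orient a b c > 0" and cda: "orient c d a > 0"
  shows "convex hull {a, b, c} \<inter> convex hull {a, c, d} \<in> null_sets lborel"
proof -
  \<comment> \<open>A quarter turn of \<open>c - a\<close>, so that
    \<open>\<nu> \<bullet> (p - a) = orient a c p\<close>.\<close>
  define \<nu> where "\<nu> = (- snd (c - a), fst (c - a))"
  define L where "L = {p. \<nu> \<bullet> p = \<nu> \<bullet> a}"
  have "\<nu> \<noteq> 0" using abc by (auto simp: \<nu>_def orient_def zero_prod_def)
  then have "negligible L" unfolding L_def by (rule negligible_hyperplane[OF disjI1])
  moreover have "L \<in> sets borel" unfolding L_def by (simp add: borel_closed closed_hyperplane)
  ultimately have null: "L \<in> null_sets lborel"
    by (simp add: negligible_iff_null_sets null_sets_completion_iff)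
  have "convex hull {a, b, c} \<subseteq> {p. \<nu> \<bullet> p \<le> \<nu> \<bullet> a}"
    using abc by (intro hull_minimal convex_halfspace_le)
      (auto simp: \<nu>_def orient_def inner_prod_def algebra_simps)
  moreover have "convex hull {a, c, d} \<subseteq> {p. \<nu> \<bullet> p \<ge> \<nu> \<bullet> a}"
    using cda by (intro hull_minimal convex_halfspace_ge)
      (auto simp: \<nu>_def orient_def inner_prod_def algebra_simps)
  ultimately have "convex hull {a, b, c} \<inter> convex hull {a, c, d} \<subseteq> L"
    unfolding L_def by fastforce
  then show ?thesis
    using null by (rule null_sets_subset[rotated 2]) (simp add: closed_triangle borel_closed sets.Int)
qed

section \<open>Signed sectors with apex at the origin\<close>

text \<open>
  The signed moment of the triangle \<open>0 p q\<close>: on every ray from the origin a homogeneous integrand of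
  degree \<open>s + r\<close> contributes its boundary value over \<open>s + r + 2\<close>, and Simpson's rule is exact along
  the edge.
\<close>

definition sector_moment :: "nat \<Rightarrow> nat \<Rightarrow> point \<Rightarrow> point \<Rightarrow> real" where
  "sector_moment s r p q = cross p q / (s + r + 2) *
     ((power_xy s r p + 4 * power_xy s r (mid p q) + power_xy s r q) / 6)"

lemma sector_moment_swap: "sector_moment s r q p = - sector_moment s r p q"
proof -
  have "cross q p = - cross p q" "mid q p = mid p q"
    by (simp_all add: cross_def mid_def)
  then show ?thesis by (simp add: sector_moment_def add_ac)
qed

text \<open>The divergence theorem for the field
  \<open>p \<mapsto> (power_xy s r p / (s + r + 2)) *\<^sub>R p\<close>, whose divergence is the
  monomial. Both sides are polynomials in the vertices, so the identity is checked monomial by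
  monomial.\<close>

lemma sector_moment_triangle:
  assumes "s + r \<le> 2"
  shows "orient a b c / 6 * (power_xy s r (mid a b) + power_xy s r (mid b c) + power_xy s r (mid c a))
    = sector_moment s r a b + sector_moment s r b c + sector_moment s r c a"
  using assms
  by (cases rule: degree_le_2_cases)
    (simp_all add: sector_moment_def cross_def orient_def power_xy_def field_simps power2_eq_square)

lemma nxt_simps: "nxt 0 = 1" "nxt 1 = 2" "nxt 2 = 3" "nxt 3 = 0"
  by (simp_all add: nxt_def)

lemma less_4_iff: "k < (4::nat) \<longleftrightarrow> k = 0 \<or> k = 1 \<or> k = 2 \<or> k = 3"
  by auto

lemma all_less_4_iff: "(\<forall>k<4. P k) \<longleftrightarrow> P 0 \<and> P 1 \<and> P 2 \<and> P (3::nat)"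
  unfolding less_4_iff by metis

lemma strictly_ccw_iff:
  "strictly_ccw v \<longleftrightarrow> orient (v 0) (v 1) (v 2) > 0 \<and> orient (v 1) (v 2) (v 3) > 0
    \<and> orient (v 2) (v 3) (v 0) > 0 \<and> orient (v 3) (v 0) (v 1) > 0"
  unfolding strictly_ccw_def all_less_4_iff nxt_simps ..

lemma quad_eq: "quad v = convex hull {v 0, v 1, v 2, v 3}"
proof -
  have "{..<4} = {0, 1, 2, 3::nat}" by auto
  then show ?thesis by (simp add: quad_def)
qed

lemma sum_lessThan_4: "(\<Sum>k<4. f k) = f 0 + f 1 + f 2 + f (3::nat)"
  for f :: "nat \<Rightarrow> 'a::comm_monoid_add"
  by (simp add: eval_nat_numeral)

lemma moment_eq_sum_sector_moment:
  assumes "strictly_ccw v" and deg: "s + r \<le> 2"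
  shows "moment s r v = (\<Sum>k<4. sector_moment s r (v k) (v (nxt k)))"
proof -
  define a b c d where "a = v 0" and "b = v 1" and "c = v 2" and "d = v 3"
  have o: "orient a b c > 0" "orient b c d > 0" "orient c d a > 0" "orient d a b > 0"
    using assms(1) unfolding strictly_ccw_iff a_def b_def c_def d_def by blast+
  have acd: "orient a c d > 0" using o(3) by (simp add: orient_def algebra_simps)
  let ?P = "convex hull {a, b, c}" and ?Q = "convex hull {a, c, d}"
  have int: "set_integrable lborel (convex hull {x, y, z}) (power_xy s r)" for x y z
    unfolding set_integrable_def power_xy_def
    by (intro borel_integrable_compact finite_imp_compact_convex_hull continuous_intros) simp
  have "moment s r v = set_lebesgue_integral lborel (?P \<union> ?Q) (power_xy s r)"
    unfolding moment_def quad_eq quadrilateral_eq_Un_triangles[OF o, symmetric] power_xy_def[abs_def]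
    unfolding a_def b_def c_def d_def ..
  also have "\<dots> = set_lebesgue_integral lborel ?P (power_xy s r) + set_lebesgue_integral lborel ?Q (power_xy s r)"
  proof (rule set_integral_Un_AE)
    show "AE x in lborel. \<not> (x \<in> ?P \<and> x \<in> ?Q)"
      using AE_not_in[OF triangles_overlap_null[OF o(1,3)]] by simp
  qed (use int in \<open>simp_all add: closed_triangle borel_closed\<close>)
  \<comment> \<open>The diagonal is traversed from \<open>c\<close> to \<open>a\<close> in one
    triangle and from \<open>a\<close> to \<open>c\<close> in the other, so its two sectors
    cancel.\<close>
  also have "\<dots> = sector_moment s r a b + sector_moment s r b c + sector_moment s r c d + sector_moment s r d a"
    unfolding triangle_moment[OF o(1) deg] triangle_moment[OF acd deg] sector_moment_triangle[OF deg]
    by (simp add: sector_moment_swap[of s r c a])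
  also have "\<dots> = (\<Sum>k<4. sector_moment s r (v k) (v (nxt k)))"
    unfolding sum_lessThan_4 nxt_simps a_def b_def c_def d_def ..
  finally show ?thesis .
qed

section \<open>The semi-discrete operator\<close>

lemma norm_point: "norm (p :: point) = sqrt (fst p ^ 2 + snd p ^ 2)"
  by (simp add: norm_prod_def)

lemma unit_normal_cases:
  fixes n e :: point
  assumes "norm n = 1" and "n \<bullet> e = 0" and "e \<noteq> 0"
  shows "n = (snd e / norm e, - fst e / norm e) \<or> n = (- snd e / norm e, fst e / norm e)"
proof -
  define x y where "x = fst n" and "y = snd n"
  \<comment> \<open>The cross product of \<open>n\<close> and \<open>e\<close>. Lagrange's identity
    gives \<open>l\<^sup>2 = (norm e)\<^sup>2\<close>, and \<open>l\<close> times \<open>n\<close>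
    is the clockwise quarter turn of \<open>e\<close>; the sign of \<open>l\<close> selects the
    alternative.\<close>
  define l where "l = (x * snd e - y * fst e)"
  have n: "x\<^sup>2 + y\<^sup>2 = 1" using assms(1) by (simp add: norm_point x_def y_def)
  have e: "fst e ^ 2 + snd e ^ 2 = norm e ^ 2" by (simp add: norm_point)
  have orth: "x * fst e + y * snd e = 0"
    using assms(2) by (simp add: inner_prod_def x_def y_def)
  have "l\<^sup>2 = (x\<^sup>2 + y\<^sup>2) * (fst e ^ 2 + snd e ^ 2) - (x * fst e + y * snd e)\<^sup>2"
    unfolding l_def by algebra
  then have "l\<^sup>2 = norm e ^ 2" using n e orth by simp
  then have l: "l = norm e \<or> l = - norm e" by (simp add: power2_eq_iff)
  have "l * x = snd e * (x\<^sup>2 + y\<^sup>2) - y * (x * fst e + y * snd e)"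
    "l * y = x * (x * fst e + y * snd e) - fst e * (x\<^sup>2 + y\<^sup>2)"
    by (simp_all add: l_def algebra_simps power2_eq_square)
  then have "l * x = snd e" "l * y = - fst e" by (simp_all add: n orth)
  moreover have "l \<noteq> 0" using l assms(3) by auto
  ultimately have "x = snd e / l" "y = - fst e / l" by (metis nonzero_mult_div_cancel_left)+
  then have "n = (snd e / l, - fst e / l)" by (simp add: x_def y_def prod_eq_iff)
  with l show ?thesis by auto
qed

text \<open>The cell lies to the left of each edge, so the clockwise quarter turn of the edge
  direction points outward. The opposite unit normal is excluded by the vertex after the edge, which
  lies strictly to the left.\<close>

lemma outward_normal_eq:
  assumes ccw: "strictly_ccw v" and k: "k < 4"
  defines "e \<equiv> v (nxt k) - v k"
  shows "outward_normal v k = (snd e / norm e, - fst e / norm e)" and "e \<noteq> 0"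
proof -
  have left: "orient (v k) (v (nxt k)) (v (nxt (nxt k))) > 0" using ccw k by (simp add: strictly_ccw_def)
  show e: "e \<noteq> 0" using left by (auto simp: orient_def e_def prod_eq_iff)
  have cross: "cross e (p - v k) = orient (v k) (v (nxt k)) p" for p
    by (simp add: cross_def orient_def e_def)
  have side: "cross e (v j - v k) \<ge> 0" if "j < 4" for j
  proof -
    have cyc: "orient p q r = orient q r p" and degen: "orient p q p = 0" "orient p q q = 0" for p q r
      by (simp_all add: orient_def algebra_simps)
    show ?thesis
      \<comment> \<open>The endpoints of the edge give zero; for the other two vertices, cyclic
        invariance of \<open>orient\<close> leads back to a counterclockwise condition.\<close>
      using that k ccw unfolding cross less_4_iff strictly_ccw_iff
      by (elim disjE; simp only: nxt_simps; metis cyc degen less_imp_le order_refl)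
  qed
  let ?n = "(snd e / norm e, - fst e / norm e)"
  have n: "?n \<bullet> p = - cross e p / norm e" for p
    by (simp add: inner_prod_def cross_def diff_divide_distrib)
  have "(snd e / norm e)\<^sup>2 + (- fst e / norm e)\<^sup>2 = (fst e ^ 2 + snd e ^ 2) / (norm e)\<^sup>2"
    by (simp add: power_divide add_divide_distrib)
  also have "fst e ^ 2 + snd e ^ 2 = (norm e)\<^sup>2" by (simp add: norm_point)
  also have "(norm e)\<^sup>2 / (norm e)\<^sup>2 = 1" using e by simp
  finally have unit: "norm ?n = 1" by (simp add: norm_point)
  show "outward_normal v k = ?n"
    unfolding outward_normal_def e_def[symmetric]
  proof (rule the_equality)
    have "quad v \<subseteq> {p. ?n \<bullet> p \<le> ?n \<bullet> v k}"
      unfolding quad_def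
    proof (intro hull_minimal convex_halfspace_le subsetI)
      fix p assume "p \<in> v ` {..<4}"
      then have "?n \<bullet> (p - v k) \<le> 0" unfolding n using side by auto
      then show "p \<in> {p. ?n \<bullet> p \<le> ?n \<bullet> v k}" by (simp add: inner_diff_right)
    qed
    then have "\<forall>p\<in>quad v. ?n \<bullet> (p - v k) \<le> 0" by (auto simp: inner_diff_right)
    moreover have "?n \<bullet> e = 0" unfolding n by (simp add: cross_def)
    ultimately show "norm ?n = 1 \<and> ?n \<bullet> e = 0 \<and> (\<forall>p\<in>quad v. ?n \<bullet> (p - v k) \<le> 0)"
      using unit by blast
  next
    fix n' assume n': "norm n' = 1 \<and> n' \<bullet> e = 0 \<and> (\<forall>p\<in>quad v. n' \<bullet> (p - v k) \<le> 0)"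
    let ?c = "v (nxt (nxt k))"
    have "?c \<in> quad v" unfolding quad_def by (intro hull_inc imageI) (simp add: nxt_def)
    with n' have "n' \<bullet> (?c - v k) \<le> 0" by blast
    moreover have "(- snd e / norm e, fst e / norm e) \<bullet> (?c - v k) > 0"
    proof -
      have "(- snd e / norm e, fst e / norm e) \<bullet> (?c - v k) = orient (v k) (v (nxt k)) ?c / norm e"
        unfolding cross[symmetric] by (simp add: inner_prod_def cross_def diff_divide_distrib)
      then show ?thesis using left e by simp
    qed
    ultimately show "n' = ?n" using unit_normal_cases[of n' e] n' e by auto
  qed
qed

text \<open>The edge length is absorbed into \<open>cross\<close>: for an edge of a counterclockwise
  cell, length times normal velocity is \<open>cross u (q - p)\<close>, polynomial in the
  vertices.\<close>

definition edge_flux :: "nat \<Rightarrow> nat \<Rightarrow> point \<Rightarrow> point \<Rightarrow> point \<Rightarrow> point \<Rightarrow> real" where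
  "edge_flux s r p q w z =
     (power_xy s r p * cross w (q - p) + 4 * power_xy s r (mid p q) * cross (mid w z) (q - p)
      + power_xy s r q * cross z (q - p)) / 6"

lemma moment_operator_eq_sum_edge_flux:
  assumes "strictly_ccw v"
  shows "moment_operator s r w v = (\<Sum>k<4. edge_flux s r (v k) (v (nxt k)) (w k) (w (nxt k)))"
  unfolding moment_operator_def
proof (intro sum.cong refl)
  fix k :: nat assume "k \<in> {..<4}"
  then have k: "k < 4" by simp
  let ?e = "v (nxt k) - v k"
  have len: "edge_length v k = norm ?e" by (simp add: edge_length_def dist_norm norm_minus_commute)
  have "x * (a * (b / x) + c * (- d / x)) = a * b - c * d" if "x \<noteq> 0" for a b c d x :: real
    using that by (simp add: field_simps)
  then have "norm ?e * (fst u * (snd ?e / norm ?e) + snd u * (- fst ?e / norm ?e))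
      = fst u * snd ?e - snd u * fst ?e" for u :: point
    using outward_normal_eq(2)[OF assms k] by (metis norm_eq_zero)
  then have normal: "edge_length v k * (u \<bullet> outward_normal v k) = cross u ?e" for u
    by (simp add: len outward_normal_eq(1)[OF assms k] inner_prod_def cross_def)
  have flux: "edge_length v k * (c * x * y * (u \<bullet> outward_normal v k)) = c * (x * y * cross u ?e)" for c x y u
    unfolding normal[symmetric] by (simp only: mult_ac)
  have interp: "edge_interp u k 1 = u k" "edge_interp u k 2 = mid (u k) (u (nxt k))"
    "edge_interp u k 3 = u (nxt k)" for u
    by (simp_all add: edge_interp_def gl_node_def mid_def)
  have weight: "gl_weight 1 = 1/6" "gl_weight 2 = 2/3" "gl_weight 3 = 1/6"
    by (simp_all add: gl_weight_def)
  have sum3: "(\<Sum>g = 1..3. f g) = f 1 + f 2 + f 3" for f :: "nat \<Rightarrow> real"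
    by (simp add: eval_nat_numeral)
  show "edge_length v k * (\<Sum>g = 1..3. gl_weight g * fst (edge_interp v k g) ^ s *
        snd (edge_interp v k g) ^ r * (edge_interp w k g \<bullet> outward_normal v k))
    = edge_flux s r (v k) (v (nxt k)) (w k) (w (nxt k))"
    unfolding sum3 interp weight distrib_left flux edge_flux_def power_xy_def
    by (simp add: add_divide_distrib del: fst_mid snd_mid)
qed

section \<open>Exactness of the time integration\<close>

text \<open>As \<open>L\<close> does not see the state, the stages collapse: the outer factor 2/3
  times the inner 1/4, 1, 1/4 gives Simpson's weights 1/6, 2/3, 1/6.\<close>

lemma ssprk3_step_eq_simpson:
  "ssprk3_step L t h M = M + h * ((L t + 4 * L (t + h/2) + L (t + h)) / 6)"
  by (simp add: ssprk3_step_def Let_def algebra_simps add_divide_distrib)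

section \<open>Rate of change of a sector under linear motion\<close>

text \<open>Flux through the moving side \<open>0 p\<close> of a sector.\<close>

definition side_flux :: "nat \<Rightarrow> nat \<Rightarrow> point \<Rightarrow> point \<Rightarrow> real" where
  "side_flux s r p w = power_xy s r p * cross w p / (s + r + 2)"

text \<open>Reynolds transport along the boundary \<open>0 p\<close>, \<open>p q\<close>,
  \<open>q 0\<close>; the last side is traversed backwards, hence the minus sign. On a side, the
  point at fraction \<lambda> moves with \<lambda> times the endpoint velocity, and integrating the
  power \<open>s + r + 1\<close> of \<lambda> yields the divisor in
  \<open>side_flux\<close>.\<close>

definition sector_rate :: "nat \<Rightarrow> nat \<Rightarrow> point \<Rightarrow> point \<Rightarrow> point \<Rightarrow> point \<Rightarrow> real" where
  "sector_rate s r p q w z = edge_flux s r p q w z + side_flux s r p w - side_flux s r q z"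

lemma cross_scaleR_left: "cross (c *\<^sub>R p) q = c * cross p q"
  by (simp add: cross_def algebra_simps)

lemma sector_rate_scaleR: "sector_rate s r p q (c *\<^sub>R w) (c *\<^sub>R z) = c * sector_rate s r p q w z"
proof -
  have "mid (c *\<^sub>R w) (c *\<^sub>R z) = c *\<^sub>R mid w z" by (simp add: mid_def scaleR_right_distrib)
  then show ?thesis
    by (simp add: sector_rate_def edge_flux_def side_flux_def cross_scaleR_left
        add_divide_distrib algebra_simps)
qed

lemma power_xy_mid: "power_xy s r (mid p q) = power_xy s r (p + q) / 2 ^ (s + r)"
  by (simp add: power_xy_def power_divide power_add)

text \<open>
  Centring the time interval and clearing denominators leaves a
  polynomial identity with integer coefficients.
\<close>

lemma sector_moment_increment_centred:
  assumes deg: "s + r \<le> 2"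
  shows "3 * (sector_moment s r (p + w) (q + z) - sector_moment s r (p - w) (q - z))
    = sector_rate s r (p - w) (q - z) w z + 4 * sector_rate s r p q w z
      + sector_rate s r (p + w) (q + z) w z"
proof -
  define f where "f = power_xy s r"
  define n where "n = real (s + r + 2)"
  \<comment> \<open>Simpson's factor 4 times the \<open>1 / 2 ^ (s + r)\<close> by which homogeneity
    turns a midpoint into a sum; it is 4, 2 or 1 in degree 0, 1 or 2.\<close>
  define \<kappa> where "\<kappa> = 4 / (2 :: real) ^ (s + r)"
  \<comment> \<open>\<open>E\<close> and \<open>R\<close> are the sector moment and its rate times
    the common denominator \<open>12 * n\<close>.\<close>
  define E where "E p q = 2 * (cross p q * (f p + \<kappa> * f (p + q) + f q))" for p q
  define R where "R p q w z = n * (2 * f p * cross w (q - p) + \<kappa> * f (p + q) * cross (w + z) (q - p)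
      + 2 * f q * cross z (q - p)) + 12 * (f p * cross w p - f q * cross z q)" for p q w z
  have n: "n > 0" by (simp add: n_def)
  have mid: "4 * power_xy s r (mid p q) = \<kappa> * f (p + q)" for p q
    by (simp add: power_xy_mid f_def \<kappa>_def)
  have cross_mid: "cross (mid w z) e = cross (w + z) e / 2" for w z e
    by (simp add: cross_def diff_divide_distrib)
  have E: "sector_moment s r p q = E p q / (12 * n)" for p q
    unfolding sector_moment_def mid n_def[symmetric] unfolding f_def[symmetric] E_def by simp
  have R: "sector_rate s r p q w z = R p q w z / (12 * n)" for p q w z
    unfolding sector_rate_def edge_flux_def side_flux_def mid cross_mid n_def[symmetric]
    unfolding f_def[symmetric] R_def using n by (simp add: field_simps)
  \<comment> \<open>Simpson's rule on the time interval from -1 to 1: its length 2 over 6 accounts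
    for the factor 3.\<close>
  have "3 * (E (p + w) (q + z) - E (p - w) (q - z))
      = R (p - w) (q - z) w z + 4 * R p q w z + R (p + w) (q + z) w z"
    using deg
  proof (cases rule: degree_le_2_cases)
    case 1
    then have *: "n = 2" "\<kappa> = 4" "f = (\<lambda>p. 1)" by (simp_all add: n_def \<kappa>_def f_def power_xy_def[abs_def])
    show ?thesis
      unfolding E_def R_def cross_def * fst_add snd_add fst_diff snd_diff by algebra
  next
    case 2
    then have *: "n = 3" "\<kappa> = 2" "f = (\<lambda>p. fst p)" by (simp_all add: n_def \<kappa>_def f_def power_xy_def[abs_def])
    show ?thesis
      unfolding E_def R_def cross_def * fst_add snd_add fst_diff snd_diff by algebra
  next
    case 3
    then have *: "n = 3" "\<kappa> = 2" "f = (\<lambda>p. snd p)" by (simp_all add: n_def \<kappa>_def f_def power_xy_def[abs_def])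
    show ?thesis
      unfolding E_def R_def cross_def * fst_add snd_add fst_diff snd_diff by algebra
  next
    case 4
    then have *: "n = 4" "\<kappa> = 1" "f = (\<lambda>p. fst p ^ 2)" by (simp_all add: n_def \<kappa>_def f_def power_xy_def[abs_def])
    show ?thesis
      unfolding E_def R_def cross_def * fst_add snd_add fst_diff snd_diff by algebra
  next
    case 5
    then have *: "n = 4" "\<kappa> = 1" "f = (\<lambda>p. fst p * snd p)" by (simp_all add: n_def \<kappa>_def f_def power_xy_def[abs_def])
    show ?thesis
      unfolding E_def R_def cross_def * fst_add snd_add fst_diff snd_diff by algebra
  next
    case 6
    then have *: "n = 4" "\<kappa> = 1" "f = (\<lambda>p. snd p ^ 2)" by (simp_all add: n_def \<kappa>_def f_def power_xy_def[abs_def])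
    show ?thesis
      unfolding E_def R_def cross_def * fst_add snd_add fst_diff snd_diff by algebra
  qed
  then show ?thesis
    unfolding E R using n by (simp add: field_simps)
qed

text \<open>The centred identity at the half-step positions with velocities scaled by
  \<open>h/2\<close>; homogeneity of the rate in the velocities pulls this factor out.\<close>

lemma sector_moment_increment:
  assumes "s + r \<le> 2"
  shows "sector_moment s r (p + h *\<^sub>R w) (q + h *\<^sub>R z) - sector_moment s r p q
    = h * ((sector_rate s r p q w z + 4 * sector_rate s r (p + (h/2) *\<^sub>R w) (q + (h/2) *\<^sub>R z) w z
            + sector_rate s r (p + h *\<^sub>R w) (q + h *\<^sub>R z) w z) / 6)"
proof -
  have "p + (h/2) *\<^sub>R w + (h/2) *\<^sub>R w = p + h *\<^sub>R w" for p w :: point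
    by (metis add.assoc field_sum_of_halves scaleR_left_distrib)
  then show ?thesis
    using sector_moment_increment_centred[OF assms, of "p + (h/2) *\<^sub>R w" "(h/2) *\<^sub>R w" "q + (h/2) *\<^sub>R z" "(h/2) *\<^sub>R z"]
    unfolding sector_rate_scaleR by (simp add: field_simps)
qed

text \<open>Cyclic telescoping, which cancels the sides shared by neighbouring sectors.\<close>

lemma sum_diff_nxt: "(\<Sum>k<4. f k - f (nxt k)) = (0::real)"
  unfolding sum_lessThan_4 nxt_simps by simp

text \<open>Sectors express the moments at the two end times and edge fluxes express the operator at
  all three Simpson nodes; each conversion uses the orientation at its own time.\<close>

lemma moment_increment:
  assumes deg: "s + r \<le> 2"
    and ccw: "strictly_ccw v" "strictly_ccw (\<lambda>k. v k + (h/2) *\<^sub>R w k)" "strictly_ccw (\<lambda>k. v k + h *\<^sub>R w k)"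
  shows "moment s r (\<lambda>k. v k + h *\<^sub>R w k) = moment s r v +
    h * ((moment_operator s r w v + 4 * moment_operator s r w (\<lambda>k. v k + (h/2) *\<^sub>R w k)
      + moment_operator s r w (\<lambda>k. v k + h *\<^sub>R w k)) / 6)"
proof -
  define F where "F \<tau> k = edge_flux s r (v k + \<tau> *\<^sub>R w k) (v (nxt k) + \<tau> *\<^sub>R w (nxt k)) (w k) (w (nxt k))" for \<tau> k
  define B where "B \<tau> k = side_flux s r (v k + \<tau> *\<^sub>R w k) (w k)" for \<tau> k
  have op: "(\<Sum>k<4. F \<tau> k + (B \<tau> k - B \<tau> (nxt k))) = moment_operator s r w (\<lambda>k. v k + \<tau> *\<^sub>R w k)"
    if "strictly_ccw (\<lambda>k. v k + \<tau> *\<^sub>R w k)" for \<tau>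
    unfolding moment_operator_eq_sum_edge_flux[OF that] sum.distrib sum_diff_nxt F_def by simp
  have sum_simpson: "(\<Sum>k<4. h * ((a k + 4 * b k + c k) / 6))
      = h * (((\<Sum>k<4. a k) + 4 * (\<Sum>k<4. b k) + (\<Sum>k<4. c k)) / 6)" for a b c :: "nat \<Rightarrow> real"
    by (simp add: sum.distrib flip: sum_distrib_left sum_divide_distrib)
  have "moment s r (\<lambda>k. v k + h *\<^sub>R w k) - moment s r v
      = (\<Sum>k<4. h * (((F 0 k + (B 0 k - B 0 (nxt k))) + 4 * (F (h/2) k + (B (h/2) k - B (h/2) (nxt k)))
          + (F h k + (B h k - B h (nxt k)))) / 6))"
    unfolding moment_eq_sum_sector_moment[OF ccw(1) deg] moment_eq_sum_sector_moment[OF ccw(3) deg]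
      sum_subtractf[symmetric] sector_moment_increment[OF deg] sector_rate_def F_def B_def
    by (simp add: add_diff_eq)
  also have "\<dots> = h * (((\<Sum>k<4. F 0 k + (B 0 k - B 0 (nxt k))) + 4 * (\<Sum>k<4. F (h/2) k + (B (h/2) k - B (h/2) (nxt k)))
          + (\<Sum>k<4. F h k + (B h k - B h (nxt k)))) / 6)"
    by (rule sum_simpson)
  also have "\<dots> = h * ((moment_operator s r w v + 4 * moment_operator s r w (\<lambda>k. v k + (h/2) *\<^sub>R w k)
      + moment_operator s r w (\<lambda>k. v k + h *\<^sub>R w k)) / 6)"
    using ccw op[of 0] op[of "h/2"] op[of h] by simp
  finally show ?thesis by simp
qed

theorem theorem4p7:
  fixes x\<^sub>0 x\<^sub>1 :: "nat \<Rightarrow> point" and T :: real and t :: "nat \<Rightarrow> real" and N :: nat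
  assumes regular: "\<forall>\<tau>\<in>{0..T}. regular_cell (moving_vertices x\<^sub>0 x\<^sub>1 T \<tau>)"
    and start: "t 0 = 0" and final: "t N = T"
    and increasing: "\<forall>l<N. t l < t (Suc l)"
  shows "\<forall>l<N. \<forall>s r. s + r \<le> 2 \<longrightarrow>
    evolved_moment s r x\<^sub>0 x\<^sub>1 T t (Suc l) = moment s r (moving_vertices x\<^sub>0 x\<^sub>1 T (t (Suc l)))"
proof -
  let ?V = "moving_vertices x\<^sub>0 x\<^sub>1 T" and ?w = "vertex_velocity x\<^sub>0 x\<^sub>1 T"
  have ccw: "strictly_ccw (?V \<tau>)" if "0 \<le> \<tau>" "\<tau> \<le> T" for \<tau>
    using regular that by (auto simp: regular_cell_def)
  have shift: "?V (\<tau> + h) = (\<lambda>k. ?V \<tau> k + h *\<^sub>R ?w k)" for \<tau> h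
    by (simp add: moving_vertices_def fun_eq_iff scaleR_left_distrib)
  \<comment> \<open>Levels are bounded below by induction upward from \<open>t 0 = 0\<close> and
    above by induction downward from \<open>t N = T\<close>, so every stage time lies where the cell
    is regular.\<close>
  have ge_0: "0 \<le> t l" if "l \<le> N" for l
    using that by (induction l) (use start increasing in \<open>auto simp: Suc_le_eq intro: order_trans less_imp_le\<close>)
  have le_T: "t l \<le> T" if "l \<le> N" for l
    using that by (induction l rule: inc_induct) (use final increasing in \<open>auto intro: order_trans less_imp_le\<close>)
  \<comment> \<open>Stated for \<open>l\<close> rather than \<open>Suc l\<close>, so that the
    induction starts from the exact initial moment.\<close>
  have exact: "evolved_moment s r x\<^sub>0 x\<^sub>1 T t l = moment s r (?V (t l))"
    if deg: "s + r \<le> 2" and "l \<le> N" for s r l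
    using \<open>l \<le> N\<close>
  proof (induction l)
    case 0
    then show ?case by (simp add: start)
  next
    case (Suc l)
    define h where "h = t (Suc l) - t l"
    have h: "t (Suc l) = t l + h" by (simp add: h_def)
    have "0 \<le> t l" "t l + h \<le> T" "0 < h"
      using Suc.prems ge_0[of l] le_T[of "Suc l"] increasing by (auto simp: h_def)
    then have "strictly_ccw (?V (t l))" "strictly_ccw (?V (t l + h/2))" "strictly_ccw (?V (t l + h))"
      by (auto intro!: ccw)
    then have "moment s r (?V (t l + h)) = moment s r (?V (t l)) + h * ((moment_operator s r ?w (?V (t l))
        + 4 * moment_operator s r ?w (?V (t l + h/2)) + moment_operator s r ?w (?V (t l + h))) / 6)"
      unfolding shift by (rule moment_increment[OF deg])
    then show ?case
      using Suc by (simp add: ssprk3_step_eq_simpson h)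
  qed
  show ?thesis
    using exact by (simp add: Suc_le_eq del: evolved_moment.simps)
qed

end
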